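(* Let $(\Omega,\Sigma,\mu)$ be a probability space, let $H$ be a complex Hilbert space, and let $f\in L^2(\Omega,H)$ be a zero-mean random function. Then the auto-covariance operator $E_{ff}\in\mathcal{B}(H)$ is a nuclear (trace-class) operator.
   Context: $\Sigma$ is a complete $\sigma$-field. A function $f:\Omega\to H$ is strongly $\Sigma$-measurable if it is the $\mu$-almost everywhere norm limit of a sequence of finitely valued functions (finite sums $\sum_j\chi_{E_j}c_j$ with $E_j\in\Sigma$ disjoint, $c_j\in H$). $L^2(\Omega,H)$ is the space of strongly $\Sigma$-measurable $f:\Omega\to H$ with $\mathbb{E}[\|f\|^2]=\int_\Omega\|f(\omega)\|^2\mu(d\omega)<\infty$; integrals of $H$-valued functions are Bochner integrals, and $f$ has zero mean if $\int_\Omega f\,d\mu=0$. Inner products are linear in the first argument. $H$ need not be separable. The auto-covariance operator is $E_{ff}x=\mathbb{E}[\langle x,f\rangle f]=\int_\Omega\langle x,f(\omega)\rangle f(\omega)\,\mu(d\omega)$, $x\in H$. *)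

theory Defs
  imports "HOL-Probability.Probability"
begin

section \<open>Complex Hilbert spaces\<close>

class complex_vector = real_vector +
  fixes scaleC :: "complex \<Rightarrow> 'a \<Rightarrow> 'a"  (infixr "*\<^sub>C" 75)
  assumes scaleC_add_right: "a *\<^sub>C (x + y) = a *\<^sub>C x + a *\<^sub>C y"
    and scaleC_add_left: "(a + b) *\<^sub>C x = a *\<^sub>C x + b *\<^sub>C x"
    and scaleC_scaleC: "a *\<^sub>C (b *\<^sub>C x) = (a * b) *\<^sub>C x"
    and scaleC_one: "1 *\<^sub>C x = x"
    and scaleR_scaleC: "r *\<^sub>R x = complex_of_real r *\<^sub>C x"

text \<open>The inner product is linear in its first argument.\<close>

class complex_inner = complex_vector + real_normed_vector +
  fixes cinner :: "'a \<Rightarrow> 'a \<Rightarrow> complex"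
  assumes cinner_commute: "cinner x y = cnj (cinner y x)"
    and cinner_add_left: "cinner (x + y) z = cinner x z + cinner y z"
    and cinner_scaleC_left: "cinner (a *\<^sub>C x) y = a * cinner x y"
    and cinner_ge_zero: "0 \<le> Re (cinner x x)"
    and cinner_eq_zero_iff: "cinner x x = 0 \<longleftrightarrow> x = 0"
    and norm_eq_sqrt_cinner: "norm x = sqrt (Re (cinner x x))"

class chilbert_space = complex_inner + complete_space
begin
subclass banach ..
end

instantiation complex :: chilbert_space
begin

definition scaleC_complex :: "complex \<Rightarrow> complex \<Rightarrow> complex" where
  "scaleC_complex a x = a * x"

definition cinner_complex :: "complex \<Rightarrow> complex \<Rightarrow> complex" where
  "cinner_complex x y = x * cnj y"

instance
proof
  fix x :: complex
  show "norm x = sqrt (Re (cinner x x))"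
    by (simp add: cinner_complex_def cmod_def power2_eq_square)
qed (simp_all add: scaleC_complex_def cinner_complex_def algebra_simps scaleR_conv_of_real)

end


section \<open>Strong measurability and the Bochner integral\<close>

text \<open>
  The library's Bochner integral is restricted to second countable codomains. The definitions below
  follow it (with \<open>simple_function\<close> and \<open>simple_bochner_integral\<close> unchanged), but replace Borel
  measurability by strong measurability, so that they apply to nonseparable spaces.
  As in the library, an element of \<open>L2\<close> is a function, not an equivalence class.
\<close>

definition strongly_measurable :: "'a measure \<Rightarrow> ('a \<Rightarrow> 'b::real_normed_vector) \<Rightarrow> bool" where
  "strongly_measurable M f \<longleftrightarrow>
    (\<exists>s. (\<forall>n. simple_function M (s n)) \<and> (AE \<omega> in M. (\<lambda>n. s n \<omega>) \<longlonglongrightarrow> f \<omega>))"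

definition has_strong_integral ::
    "'a measure \<Rightarrow> ('a \<Rightarrow> 'b::real_normed_vector) \<Rightarrow> 'b \<Rightarrow> bool" where
  "has_strong_integral M f I \<longleftrightarrow> strongly_measurable M f \<and>
    (\<exists>s. (\<forall>n. Bochner_Integration.simple_bochner_integrable M (s n)) \<and>
         (\<lambda>n. \<integral>\<^sup>+\<omega>. ennreal (norm (f \<omega> - s n \<omega>)) \<partial>M) \<longlonglongrightarrow> 0 \<and>
         (\<lambda>n. Bochner_Integration.simple_bochner_integral M (s n)) \<longlonglongrightarrow> I)"

definition strong_integrable :: "'a measure \<Rightarrow> ('a \<Rightarrow> 'b::real_normed_vector) \<Rightarrow> bool" where
  "strong_integrable M f \<longleftrightarrow> (\<exists>I. has_strong_integral M f I)"

definition strong_integral :: "'a measure \<Rightarrow> ('a \<Rightarrow> 'b::real_normed_vector) \<Rightarrow> 'b" where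
  "strong_integral M f = (THE I. has_strong_integral M f I)"

definition L2 :: "'a measure \<Rightarrow> ('a \<Rightarrow> 'b::real_normed_vector) set" where
  "L2 M = {f. strongly_measurable M f \<and> (\<integral>\<^sup>+\<omega>. ennreal ((norm (f \<omega>))\<^sup>2) \<partial>M) < \<infinity>}"

definition auto_covariance :: "'a measure \<Rightarrow> ('a \<Rightarrow> 'h::complex_inner) \<Rightarrow> 'h \<Rightarrow> 'h" where
  "auto_covariance M f x = strong_integral M (\<lambda>\<omega>. cinner x (f \<omega>) *\<^sub>C f \<omega>)"


section \<open>Nuclear and trace-class operators\<close>

definition bounded_clinear :: "('a::complex_inner \<Rightarrow> 'b::complex_inner) \<Rightarrow> bool" where
  "bounded_clinear T \<longleftrightarrow> bounded_linear T \<and> (\<forall>a x. T (a *\<^sub>C x) = a *\<^sub>C T x)"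

definition nuclear :: "('a::complex_inner \<Rightarrow> 'b::complex_inner) \<Rightarrow> bool" where
  "nuclear T \<longleftrightarrow> bounded_clinear T \<and>
    (\<exists>(\<phi> :: nat \<Rightarrow> 'a \<Rightarrow> complex) (y :: nat \<Rightarrow> 'b).
      (\<forall>n. bounded_clinear (\<phi> n)) \<and>
      summable (\<lambda>n. onorm (\<phi> n) * norm (y n)) \<and>
      (\<forall>x. (\<lambda>n. \<phi> n x *\<^sub>C y n) sums T x))"

definition is_cadjoint ::
    "('a::complex_inner \<Rightarrow> 'b::complex_inner) \<Rightarrow> ('b \<Rightarrow> 'a) \<Rightarrow> bool" where
  "is_cadjoint T S \<longleftrightarrow> (\<forall>x y. cinner (T x) y = cinner x (S y))"

definition positive_operator :: "('a::complex_inner \<Rightarrow> 'a) \<Rightarrow> bool" where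
  "positive_operator T \<longleftrightarrow> bounded_clinear T \<and> (\<forall>x. cinner (T x) x \<in> \<real>\<^sub>\<ge>\<^sub>0)"

text \<open>\<open>A\<close> is the modulus \<open>(T\<^sup>* T)\<^sup>1\<^sup>/\<^sup>2\<close>; for bounded \<open>T\<close> on a Hilbert space it exists and is unique.\<close>

definition is_modulus :: "('a::complex_inner \<Rightarrow> 'a) \<Rightarrow> ('a \<Rightarrow> 'a) \<Rightarrow> bool" where
  "is_modulus T A \<longleftrightarrow> positive_operator A \<and> (\<exists>S. is_cadjoint T S \<and> A \<circ> A = S \<circ> T)"

definition orthonormal_basis :: "'a::complex_inner set \<Rightarrow> bool" where
  "orthonormal_basis B \<longleftrightarrow>
    (\<forall>e\<in>B. \<forall>e'\<in>B. cinner e e' = (if e = e' then 1 else 0)) \<and>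
    (\<forall>x. (\<forall>e\<in>B. cinner x e = 0) \<longrightarrow> x = 0)"

text \<open>
  The sum \<open>\<Sum>\<langle>|T|e, e\<rangle>\<close> of nonnegative terms does not depend on the orthonormal basis, so
  finiteness for one basis is finiteness for all. The basis may be uncountable, hence
  \<open>summable_on\<close>.
\<close>

definition trace_class :: "('a::complex_inner \<Rightarrow> 'a) \<Rightarrow> bool" where
  "trace_class T \<longleftrightarrow> bounded_clinear T \<and>
    (\<exists>A B. is_modulus T A \<and> orthonormal_basis B \<and> (\<lambda>e. Re (cinner (A e) e)) summable_on B)"

end

theory Submission
  imports Defs
begin

text \<open>
  Truncating an a.e. approximation of \<open>f\<close> gives simple functions \<open>s n\<close> with \<open>norm (s n) \<le> 2 * norm f\<close>,
  for which \<open>E[norm f * norm (f - s n)]\<close> is summable after passing to a subsequence. Their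
  covariances have finite rank and converge pointwise to \<open>E_ff\<close>, which therefore inherits
  boundedness, self-adjointness, positivity and (by Bessel's inequality) the bound
  \<open>4 * E[(norm f)\<^sup>2]\<close> on \<open>\<Sum>e. \<langle>E_ff e, e\<rangle>\<close> over an orthonormal basis. As \<open>E_ff\<close> is positive,
  it is its own modulus, so it is trace class. The nuclear representation comes from the
  telescoping series of the finite-rank covariances, whose increments have summable nuclear norms.
\<close>

section \<open>Complex inner product spaces\<close>

lemma cinner_add_right: "cinner x (y + z) = cinner x y + cinner x z"
  by (metis cinner_add_left cinner_commute complex_cnj_add)

lemma cinner_scaleC_right: "cinner x (a *\<^sub>C y) = cnj a * cinner x y"
  by (metis cinner_commute cinner_scaleC_left complex_cnj_mult)

lemma cinner_scaleR_left: "cinner (r *\<^sub>R x) y = of_real r * cinner x y"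
  by (simp add: scaleR_scaleC cinner_scaleC_left)

lemma cinner_scaleR_right: "cinner x (r *\<^sub>R y) = of_real r * cinner x y"
  by (simp add: scaleR_scaleC cinner_scaleC_right)

lemma cinner_zero_left [simp]: "cinner 0 y = 0"
  using cinner_scaleR_left[of 0 0 y] by simp

lemma cinner_zero_right [simp]: "cinner x 0 = 0"
  using cinner_scaleR_right[of x 0 0] by simp

lemma cinner_diff_left: "cinner (x - y) z = cinner x z - cinner y z"
  using cinner_add_left[of "x - y" y z] by simp

lemma cinner_diff_right: "cinner x (y - z) = cinner x y - cinner x z"
  using cinner_add_right[of x "y - z" z] by simp

lemma cinner_sum_left: "cinner (\<Sum>i\<in>A. f i) y = (\<Sum>i\<in>A. cinner (f i) y)"
  by (induction A rule: infinite_finite_induct) (simp_all add: cinner_add_left)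

lemma cinner_sum_right: "cinner x (\<Sum>i\<in>A. f i) = (\<Sum>i\<in>A. cinner x (f i))"
  by (induction A rule: infinite_finite_induct) (simp_all add: cinner_add_right)

text \<open>Conjugate symmetry makes \<open>cinner x x\<close> its own conjugate, so its imaginary
  part vanishes.\<close>

lemma cinner_self: "cinner x x = of_real ((norm x)\<^sup>2)"
proof (rule complex_eqI)
  show "Re (cinner x x) = Re (of_real ((norm x)\<^sup>2))"
    by (simp add: norm_eq_sqrt_cinner cinner_ge_zero)
  show "Im (cinner x x) = Im (of_real ((norm x)\<^sup>2))"
    by (metis Im_complex_of_real cinner_commute complex.sel(2) complex_is_Real_iff Reals_cnj_iff)
qed

lemma scaleC_zero_left [simp]: "(0::complex) *\<^sub>C (x::'a::complex_vector) = 0"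
  using scaleR_scaleC[of 0 x] by simp

lemma scaleC_zero_right [simp]: "a *\<^sub>C (0::'a::complex_vector) = 0"
  by (metis scaleC_scaleC scaleC_zero_left mult_zero_right)

lemma scaleC_diff_left: "(a - b) *\<^sub>C (x::'a::complex_vector) = a *\<^sub>C x - b *\<^sub>C x"
  using scaleC_add_left[of "a - b" b x] by simp

lemma scaleC_diff_right: "a *\<^sub>C (x - (y::'a::complex_vector)) = a *\<^sub>C x - a *\<^sub>C y"
  using scaleC_add_right[of a "x - y" y] by simp

lemma scaleC_sum_right: "a *\<^sub>C (\<Sum>i\<in>A. f i :: 'a::complex_vector) = (\<Sum>i\<in>A. a *\<^sub>C f i)"
  by (induction A rule: infinite_finite_induct) (simp_all add: scaleC_add_right)

lemma norm_scaleC: "norm (a *\<^sub>C (x::'a::complex_inner)) = cmod a * norm x"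
proof -
  have "of_real ((norm (a *\<^sub>C x))\<^sup>2) = (of_real ((cmod a * norm x)\<^sup>2) :: complex)"
    unfolding power_mult_distrib of_real_mult complex_norm_square[of a] cinner_self[of x, symmetric]
      cinner_self[of "a *\<^sub>C x", symmetric]
    by (simp add: cinner_scaleC_left cinner_scaleC_right mult.assoc)
  then show ?thesis
    by (metis mult_nonneg_nonneg norm_ge_zero of_real_eq_iff power2_eq_iff_nonneg)
qed

text \<open>With \<open>p\<close> the orthogonal projection of \<open>x\<close> onto the span of
  \<open>F\<close>, the nonnegative number \<open>cinner (x - p) (x - p)\<close> is the difference
  of the two sides.\<close>

lemma bessel_inequality:
  fixes x :: "'a::complex_inner"
  assumes "finite F" and on: "\<And>e e'. e \<in> F \<Longrightarrow> e' \<in> F \<Longrightarrow> cinner e e' = (if e = e' then 1 else 0)"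
  shows "(\<Sum>e\<in>F. (cmod (cinner x e))\<^sup>2) \<le> (norm x)\<^sup>2"
proof -
  define p where "p = (\<Sum>e\<in>F. cinner x e *\<^sub>C e)"
  define s where "s = (\<Sum>e\<in>F. (cmod (cinner x e))\<^sup>2)"
  have xp: "cinner x p = of_real s"
    unfolding p_def s_def of_real_sum complex_norm_square
    by (simp add: cinner_sum_right cinner_scaleC_right mult.commute)
  have "cinner p e = cinner x e" if "e \<in> F" for e
  proof -
    have "cinner p e = (\<Sum>e'\<in>F. if e = e' then cinner x e' else 0)"
      unfolding p_def cinner_sum_left cinner_scaleC_left
      by (rule sum.cong) (use on that in auto)
    then show ?thesis
      using that assms(1) by simp
  qed
  then have "cinner p p = cinner x p"
    \<comment> \<open>These instances expand \<open>p\<close> in the second argument only; the two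
      sums then agree because \<open>p\<close> and \<open>x\<close> have the same coefficients along
      \<open>F\<close>.\<close>
    unfolding p_def[THEN arg_cong[where f="cinner p"]] p_def[THEN arg_cong[where f="cinner x"]]
    by (simp add: cinner_sum_right cinner_scaleC_right)
  moreover have "cinner p x = of_real s"
    by (metis xp cinner_commute complex_cnj_complex_of_real)
  ultimately have "cinner (x - p) (x - p) = of_real ((norm x)\<^sup>2 - s)"
    by (simp add: cinner_diff_left cinner_diff_right xp cinner_self[of x])
  then have "0 \<le> (norm x)\<^sup>2 - s"
    by (metis cinner_ge_zero Re_complex_of_real)
  then show ?thesis
    by (simp add: s_def)
qed

text \<open>Bessel's inequality for the single unit vector \<open>y / norm y\<close>.\<close>

lemma cinner_cauchy_schwarz:
  fixes x y :: "'a::complex_inner"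
  shows "cmod (cinner x y) \<le> norm x * norm y"
proof (cases "y = 0")
  case False
  define e where "e = (1 / norm y) *\<^sub>R y"
  have "cinner e e = 1"
    using False by (simp add: e_def cinner_self)
  then have "(cmod (cinner x e))\<^sup>2 \<le> (norm x)\<^sup>2"
    using bessel_inequality[of "{e}" x] by simp
  then have "cmod (cinner x e) \<le> norm x"
    by (rule power2_le_imp_le) simp
  moreover have "cmod (cinner x e) = cmod (cinner x y) / norm y"
    by (simp add: e_def cinner_scaleR_right norm_mult norm_divide)
  ultimately show ?thesis
    using False by (simp add: field_simps)
qed simp

text \<open>The inner product is conjugate linear in its second argument, but
  \<open>bounded_bilinear\<close> asks only for real bilinearity. This gives its joint continuity,
  as the analogous fact below does for complex scaling.\<close>

lemma bounded_bilinear_cinner: "bounded_bilinear (cinner :: 'a::complex_inner \<Rightarrow> 'a \<Rightarrow> complex)"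
proof
  show "\<exists>K. \<forall>a b :: 'a. norm (cinner a b) \<le> norm a * norm b * K"
    by (intro exI[of _ 1]) (simp add: cinner_cauchy_schwarz)
qed (simp_all add: cinner_add_left cinner_add_right cinner_scaleR_left cinner_scaleR_right
      scaleR_conv_of_real)

lemma bounded_bilinear_scaleC:
  "bounded_bilinear (scaleC :: complex \<Rightarrow> 'a::complex_inner \<Rightarrow> 'a)"
proof
  show "\<exists>K. \<forall>a (b :: 'a). norm (a *\<^sub>C b) \<le> norm a * norm b * K"
    by (intro exI[of _ 1]) (simp add: norm_scaleC)
qed (simp_all add: scaleC_add_left scaleC_add_right scaleR_scaleC scaleC_scaleC
      scaleC_complex_def mult.commute)

lemmas tendsto_cinner = bounded_bilinear.tendsto[OF bounded_bilinear_cinner]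
lemmas tendsto_scaleC = bounded_bilinear.tendsto[OF bounded_bilinear_scaleC]

text \<open>Zorn's lemma yields a maximal orthonormal set. A nonzero vector orthogonal to all of it
  could be normalised and added, contradicting maximality.\<close>

lemma ex_orthonormal_basis: "\<exists>B :: 'a::complex_inner set. orthonormal_basis B"
proof -
  define on :: "'a set \<Rightarrow> bool"
    where "on B \<longleftrightarrow> (\<forall>e\<in>B. \<forall>e'\<in>B. cinner e e' = (if e = e' then 1 else 0))" for B
  have "\<exists>B\<in>Collect on. \<forall>X\<in>Collect on. B \<subseteq> X \<longrightarrow> X = B"
  proof (rule subset_Zorn')
    fix C assume C: "subset.chain (Collect on) C"
    have "on (\<Union>C)"
      unfolding on_def
    proof (intro ballI)
      fix e e' assume "e \<in> \<Union>C" "e' \<in> \<Union>C"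
      then obtain X Y where XY: "X \<in> C" "Y \<in> C" "e \<in> X" "e' \<in> Y"
        by blast
      then have "X \<subseteq> Y \<or> Y \<subseteq> X"
        using C by (meson subset_chain_def)
      then have "\<exists>Z\<in>C. e \<in> Z \<and> e' \<in> Z"
        using XY by (meson subsetD)
      then obtain Z where "Z \<in> C" "e \<in> Z" "e' \<in> Z"
        by blast
      moreover have "on Z"
        using C \<open>Z \<in> C\<close> unfolding subset_chain_def by (meson mem_Collect_eq subsetD)
      ultimately show "cinner e e' = (if e = e' then 1 else 0)"
        by (simp add: on_def)
    qed
    then show "\<Union>C \<in> Collect on" by simp
  qed
  then obtain B where B: "on B" and max: "\<And>X. on X \<Longrightarrow> B \<subseteq> X \<Longrightarrow> X = B"
    by auto
  have "x = 0" if x: "\<And>e. e \<in> B \<Longrightarrow> cinner x e = 0" for x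
  proof (rule ccontr)
    assume "x \<noteq> 0"
    define u where "u = (1 / norm x) *\<^sub>R x"
    have uu: "cinner u u = 1"
      using \<open>x \<noteq> 0\<close> by (simp add: u_def cinner_self)
    have ue: "cinner u e = 0" if "e \<in> B" for e
      using x[OF that] by (simp add: u_def cinner_scaleR_left)
    then have eu: "cinner e u = 0" if "e \<in> B" for e
      by (metis that cinner_commute complex_cnj_zero)
    have "u \<notin> B"
      using ue[of u] uu by (metis zero_neq_one)
    then have "on (insert u B)"
      using B uu ue eu by (auto simp: on_def)
    then show False
      using max[of "insert u B"] \<open>u \<notin> B\<close> by (metis insertI1 subset_insertI)
  qed
  then have "orthonormal_basis B"
    using B by (simp add: orthonormal_basis_def on_def)
  then show ?thesis ..
qed

section \<open>Nuclear operators\<close>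

text \<open>Absolute summability is insensitive to order, so a representation over any countable
  index set can be enumerated. This allows structured indices for the rank-one terms later
  on.\<close>

lemma nuclear_countableI:
  fixes T :: "'a::complex_inner \<Rightarrow> 'b::complex_inner"
  assumes T: "bounded_clinear T" and "countable I"
    and \<phi>: "\<And>i. i \<in> I \<Longrightarrow> bounded_clinear (\<phi> i)"
    and abs: "(\<lambda>i. onorm (\<phi> i) * norm (y i)) summable_on I"
    and sum: "\<And>x. ((\<lambda>i. \<phi> i x *\<^sub>C y i) has_sum T x) I"
  shows "nuclear T"
proof -
  define h where "h = to_nat_on I"
  define g where "g = inv_into I h"
  have inj: "inj_on h I"
    using \<open>countable I\<close> by (simp add: h_def inj_on_to_nat_on)
  \<comment> \<open>Indices that the enumeration misses, as happens for finite \<open>I\<close>,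
    receive the zero functional and contribute nothing.\<close>
  define \<psi> where "\<psi> n = (if n \<in> h ` I then \<phi> (g n) else (\<lambda>_. 0))" for n
  define z where "z n = y (g n)" for n
  have gh: "g (h i) = i" if "i \<in> I" for i
    using inj that by (simp add: g_def)
  have "bounded_clinear (\<psi> n)" for n
    using \<phi> gh by (auto simp: \<psi>_def bounded_clinear_def)
  moreover have "summable (\<lambda>n. onorm (\<psi> n) * norm (z n))"
  proof (rule summable_on_imp_summable)
    have "(\<lambda>n. onorm (\<psi> n) * norm (z n)) summable_on h ` I"
      using abs unfolding summable_on_reindex[OF inj]
      by (rule summable_on_cong[THEN iffD1, rotated]) (simp add: \<psi>_def z_def gh)
    then show "(\<lambda>n. onorm (\<psi> n) * norm (z n)) summable_on UNIV"
      by (rule summable_on_cong_neutral[THEN iffD1, rotated -1]) (auto simp: \<psi>_def onorm_zero)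
  qed
  moreover have "(\<lambda>n. \<psi> n x *\<^sub>C z n) sums T x" for x
  proof (rule has_sum_imp_sums)
    have "((\<lambda>n. \<psi> n x *\<^sub>C z n) has_sum T x) (h ` I)"
      using sum[of x] unfolding has_sum_reindex[OF inj]
      by (rule has_sum_cong[THEN iffD1, rotated]) (simp add: \<psi>_def z_def gh)
    then show "((\<lambda>n. \<psi> n x *\<^sub>C z n) has_sum T x) UNIV"
      by (rule has_sum_cong_neutral[THEN iffD1, rotated -1]) (auto simp: \<psi>_def)
  qed
  ultimately show ?thesis
    using T unfolding nuclear_def by blast
qed

section \<open>Strong measurability and the strong integral\<close>

text \<open>The library hides the unqualified names of these two constants.\<close>

abbreviation simple_bochner_integrable :: "'a measure \<Rightarrow> ('a \<Rightarrow> 'b::real_vector) \<Rightarrow> bool" where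
  "simple_bochner_integrable \<equiv> Bochner_Integration.simple_bochner_integrable"

abbreviation simple_bochner_integral :: "'a measure \<Rightarrow> ('a \<Rightarrow> 'b::real_vector) \<Rightarrow> 'b" where
  "simple_bochner_integral \<equiv> Bochner_Integration.simple_bochner_integral"

section \<open>Closure properties of strong measurability and its relation to Borel
  measurability\<close>

lemma strongly_measurable_simple_function:
  "simple_function M f \<Longrightarrow> strongly_measurable M f"
  unfolding strongly_measurable_def by (intro exI[of _ "\<lambda>_. f"]) simp

text \<open>Simple approximations of \<open>f\<close> and \<open>g\<close> are combined pointwise by
  \<open>h\<close>; sequential continuity carries the almost everywhere limits along. One-argument
  maps are covered by an \<open>h\<close> that ignores an argument.\<close>

lemma strongly_measurable_compose2:
  fixes f :: "'a \<Rightarrow> 'b::real_normed_vector" and g :: "'a \<Rightarrow> 'c::real_normed_vector"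
    and h :: "'b \<Rightarrow> 'c \<Rightarrow> 'd::real_normed_vector"
  assumes "strongly_measurable M f" "strongly_measurable M g"
    and h: "\<And>(s :: nat \<Rightarrow> 'b) t a b. s \<longlonglongrightarrow> a \<Longrightarrow> t \<longlonglongrightarrow> b \<Longrightarrow> (\<lambda>n. h (s n) (t n)) \<longlonglongrightarrow> h a b"
  shows "strongly_measurable M (\<lambda>\<omega>. h (f \<omega>) (g \<omega>))"
proof -
  obtain s where s: "\<And>n. simple_function M (s n)" "AE \<omega> in M. (\<lambda>n. s n \<omega>) \<longlonglongrightarrow> f \<omega>"
    using assms(1) by (auto simp: strongly_measurable_def)
  obtain t where t: "\<And>n. simple_function M (t n)" "AE \<omega> in M. (\<lambda>n. t n \<omega>) \<longlonglongrightarrow> g \<omega>"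
    using assms(2) by (auto simp: strongly_measurable_def)
  have "simple_function M (\<lambda>\<omega>. h (s n \<omega>) (t n \<omega>))" for n
    using s(1) t(1) by (rule simple_function_compose2)
  moreover have "AE \<omega> in M. (\<lambda>n. h (s n \<omega>) (t n \<omega>)) \<longlonglongrightarrow> h (f \<omega>) (g \<omega>)"
    using s(2) t(2) by eventually_elim (rule h)
  ultimately show ?thesis
    unfolding strongly_measurable_def by (intro exI[of _ "\<lambda>n \<omega>. h (s n \<omega>) (t n \<omega>)"]) simp
qed

text \<open>The limit \<open>g\<close> of the simple functions is measurable and equals
  \<open>f\<close> almost everywhere. In a complete measure space, preimages that differ only on a
  null set are measurable together.\<close>

lemma (in complete_measure) borel_measurable_strongly_measurable:
  fixes f :: "'a \<Rightarrow> real"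
  assumes "strongly_measurable M f"
  shows "f \<in> borel_measurable M"
proof -
  obtain s where s: "\<And>n. simple_function M (s n)" "AE \<omega> in M. (\<lambda>n. s n \<omega>) \<longlonglongrightarrow> f \<omega>"
    using assms by (auto simp: strongly_measurable_def)
  define g where "g \<omega> = lim (\<lambda>n. s n \<omega>)" for \<omega>
  have g: "g \<in> borel_measurable M"
    unfolding g_def using s(1) by (intro borel_measurable_lim_metric borel_measurable_simple_function)
  have fg: "AE \<omega> in M. g \<omega> = f \<omega>"
    using s(2) by eventually_elim (simp add: g_def limI)
  show ?thesis
  proof (rule measurableI)
    fix A :: "real set" assume A: "A \<in> sets borel"
    show "f -` A \<inter> space M \<in> sets M"
    proof (rule in_sets_AE)
      show "AE \<omega> in M. \<omega> \<in> g -` A \<inter> space M \<longleftrightarrow> \<omega> \<in> f -` A \<inter> space M"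
        using fg by eventually_elim auto
    qed (use measurable_sets[OF g A] in auto)
  qed simp
qed

lemma (in complete_measure) borel_measurable_norm_strongly_measurable:
  assumes "strongly_measurable M f"
  shows "(\<lambda>\<omega>. norm (f \<omega>)) \<in> borel_measurable M"
  by (rule borel_measurable_strongly_measurable,
      rule strongly_measurable_compose2[OF assms assms, where h = "\<lambda>a b. norm a"])
    (rule tendsto_norm)

lemma strongly_measurable_diff:
  "strongly_measurable M f \<Longrightarrow> strongly_measurable M g \<Longrightarrow>
    strongly_measurable M (\<lambda>\<omega>. f \<omega> - g \<omega>)"
  by (rule strongly_measurable_compose2[where h = "(-)"]) (auto intro: tendsto_diff)

section \<open>Integrals of simple functions over a finite measure\<close>

lemma (in finite_measure) simple_bochner_integrable_simple_function:
  "simple_function M s \<Longrightarrow> simple_bochner_integrable M s"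
  by (rule simple_bochner_integrable.intros) (simp_all add: emeasure_eq_measure)

text \<open>The sum is grouped by the values of \<open>s\<close>, not of the composite, so integrals
  of different functions of one \<open>s\<close> run over the same finite set and can be compared
  termwise.\<close>

lemma (in finite_measure) simple_bochner_integral_compose:
  assumes "simple_function M s"
  shows "simple_bochner_integral M (\<lambda>\<omega>. g (s \<omega>)) =
    (\<Sum>v\<in>s ` space M. measure M {\<omega>\<in>space M. s \<omega> = v} *\<^sub>R g v)"
  by (rule simple_bochner_integral_partition[where g = s])
    (simp_all add: simple_bochner_integrable_simple_function simple_function_compose1[OF assms] assms)

lemma (in finite_measure) lebesgue_integral_compose_simple_function:
  fixes g :: "'b \<Rightarrow> real"
  assumes "simple_function M s"
  shows "(\<integral>\<omega>. g (s \<omega>) \<partial>M) = (\<Sum>v\<in>s ` space M. measure M {\<omega>\<in>space M. s \<omega> = v} * g v)"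
proof -
  have "simple_bochner_integrable M (\<lambda>\<omega>. g (s \<omega>))"
    by (rule simple_bochner_integrable_simple_function[OF simple_function_compose1[OF assms]])
  then have "has_bochner_integral M (\<lambda>\<omega>. g (s \<omega>)) (simple_bochner_integral M (\<lambda>\<omega>. g (s \<omega>)))"
    by (rule has_bochner_integral_simple_bochner_integrable)
  then have "(\<integral>\<omega>. g (s \<omega>) \<partial>M) = simple_bochner_integral M (\<lambda>\<omega>. g (s \<omega>))"
    by (rule has_bochner_integral_integral_eq)
  then show ?thesis
    using simple_bochner_integral_compose[OF assms, of g] by simp
qed

lemma (in finite_measure) integrable_simple_function_real:
  fixes g :: "'a \<Rightarrow> real"
  assumes "simple_function M g"
  shows "integrable M g"
  by (rule integrable.intros, rule has_bochner_integral_simple_bochner_integrable)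
    (rule simple_bochner_integrable_simple_function[OF assms])

text \<open>The triangle inequality through \<open>f\<close>, integrated. It yields both uniqueness
  of the strong integral and the Cauchy property of approximating integrals.\<close>

lemma (in complete_measure) norm_simple_bochner_integral_diff_le:
  fixes f :: "'a \<Rightarrow> 'b::real_normed_vector"
  assumes f: "strongly_measurable M f"
    and s: "simple_bochner_integrable M s"
    and t: "simple_bochner_integrable M t"
  shows "ennreal (norm (simple_bochner_integral M s -
      simple_bochner_integral M t)) \<le>
    (\<integral>\<^sup>+\<omega>. ennreal (norm (f \<omega> - s \<omega>)) \<partial>M) + (\<integral>\<^sup>+\<omega>. ennreal (norm (f \<omega> - t \<omega>)) \<partial>M)"
proof -
  have st: "simple_function M s" "simple_function M t"
    using s t by (auto simp: simple_bochner_integrable.simps)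
  have [measurable]: "(\<lambda>\<omega>. norm (f \<omega> - s \<omega>)) \<in> borel_measurable M"
      "(\<lambda>\<omega>. norm (f \<omega> - t \<omega>)) \<in> borel_measurable M"
    by (intro borel_measurable_norm_strongly_measurable strongly_measurable_diff f
        strongly_measurable_simple_function st)+
  have "ennreal (norm (simple_bochner_integral M s - simple_bochner_integral M t)) =
      norm (simple_bochner_integral M (\<lambda>\<omega>. s \<omega> - t \<omega>))"
    using s t by (simp add: simple_bochner_integral_diff)
  also have "\<dots> \<le> simple_bochner_integral M (\<lambda>\<omega>. norm (s \<omega> - t \<omega>))"
    using simple_bochner_integrable_compose2[of "(-)" M s t] s t
    by (auto intro!: simple_bochner_integral_norm_bound)
  also have "\<dots> = (\<integral>\<^sup>+\<omega>. norm (s \<omega> - t \<omega>) \<partial>M)"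
    using simple_bochner_integrable_compose2[of "\<lambda>x y. norm (x - y)" M s t] s t
    by (auto intro!: simple_bochner_integral_eq_nn_integral)
  also have "\<dots> \<le> (\<integral>\<^sup>+\<omega>. ennreal (norm (f \<omega> - s \<omega>)) + ennreal (norm (f \<omega> - t \<omega>)) \<partial>M)"
  proof (rule nn_integral_mono)
    fix \<omega>
    have "norm (s \<omega> - t \<omega>) \<le> norm (f \<omega> - s \<omega>) + norm (f \<omega> - t \<omega>)"
      by (metis dual_order.refl norm_diff_triangle_le norm_minus_commute)
    then show "ennreal (norm (s \<omega> - t \<omega>)) \<le> ennreal (norm (f \<omega> - s \<omega>)) + ennreal (norm (f \<omega> - t \<omega>))"
      by (simp flip: ennreal_plus add: ennreal_leI)
  qed
  also have "\<dots> = (\<integral>\<^sup>+\<omega>. ennreal (norm (f \<omega> - s \<omega>)) \<partial>M) + (\<integral>\<^sup>+\<omega>. ennreal (norm (f \<omega> - t \<omega>)) \<partial>M)"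
    by (rule nn_integral_add) auto
  finally show ?thesis .
qed

lemma (in complete_measure) has_strong_integral_unique:
  fixes f :: "'a \<Rightarrow> 'b::real_normed_vector"
  assumes "has_strong_integral M f I" "has_strong_integral M f J"
  shows "I = J"
proof -
  obtain s where f: "strongly_measurable M f"
    and s: "\<And>n. simple_bochner_integrable M (s n)"
      "(\<lambda>n. \<integral>\<^sup>+\<omega>. ennreal (norm (f \<omega> - s n \<omega>)) \<partial>M) \<longlonglongrightarrow> 0"
      "(\<lambda>n. simple_bochner_integral M (s n)) \<longlonglongrightarrow> I"
    using assms(1) by (auto simp: has_strong_integral_def)
  obtain t where t: "\<And>n. simple_bochner_integrable M (t n)"
      "(\<lambda>n. \<integral>\<^sup>+\<omega>. ennreal (norm (f \<omega> - t n \<omega>)) \<partial>M) \<longlonglongrightarrow> 0"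
      "(\<lambda>n. simple_bochner_integral M (t n)) \<longlonglongrightarrow> J"
    using assms(2) by (auto simp: has_strong_integral_def)
  have "(\<lambda>n. ennreal (norm (simple_bochner_integral M (s n) - simple_bochner_integral M (t n))))
      \<longlonglongrightarrow> ennreal (norm (I - J))"
    by (intro tendsto_ennrealI tendsto_norm tendsto_diff s t)
  moreover have "(\<lambda>n. (\<integral>\<^sup>+\<omega>. ennreal (norm (f \<omega> - s n \<omega>)) \<partial>M) +
      (\<integral>\<^sup>+\<omega>. ennreal (norm (f \<omega> - t n \<omega>)) \<partial>M)) \<longlonglongrightarrow> 0 + 0"
    by (intro tendsto_add s t)
  ultimately have "ennreal (norm (I - J)) \<le> 0 + 0"
    by (rule LIMSEQ_le)
      (intro exI[of _ 0] allI impI norm_simple_bochner_integral_diff_le[OF f s(1) t(1)])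
  then show ?thesis by simp
qed

lemma (in complete_measure) strong_integral_eq:
  "has_strong_integral M f I \<Longrightarrow> strong_integral M f = I"
  unfolding strong_integral_def by (rule the_equality) (auto intro: has_strong_integral_unique)

text \<open>The integrals of the approximations form a Cauchy sequence, which converges because the
  codomain is a Banach space; uniqueness identifies the limit with
  \<open>strong_integral M f\<close>.\<close>

lemma (in complete_measure) has_strong_integralI:
  fixes f :: "'a \<Rightarrow> 'b::banach"
  assumes f: "strongly_measurable M f"
    and s: "\<And>n. simple_bochner_integrable M (s n)"
    and lim: "(\<lambda>n. \<integral>\<^sup>+\<omega>. ennreal (norm (f \<omega> - s n \<omega>)) \<partial>M) \<longlonglongrightarrow> 0"
  shows "strong_integrable M f"
    and "(\<lambda>n. simple_bochner_integral M (s n)) \<longlonglongrightarrow> strong_integral M f"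
proof -
  let ?I = "\<lambda>n. simple_bochner_integral M (s n)"
  have "Cauchy ?I"
  proof (rule metric_CauchyI)
    fix e :: real assume "0 < e"
    then have pos: "0 < ennreal (e / 2)" by simp
    obtain N where N: "\<And>n. n \<ge> N \<Longrightarrow> (\<integral>\<^sup>+\<omega>. ennreal (norm (f \<omega> - s n \<omega>)) \<partial>M) < ennreal (e / 2)"
      using order_tendstoD(2)[OF lim pos] unfolding eventually_sequentially by blast
    have "dist (?I m) (?I n) < e" if "m \<ge> N" "n \<ge> N" for m n
    proof -
      have "ennreal (norm (?I m - ?I n)) < ennreal (e / 2) + ennreal (e / 2)"
        by (rule le_less_trans[OF norm_simple_bochner_integral_diff_le[OF f s s]])
          (intro add_strict_mono N that)
      also have "\<dots> = ennreal e"
        using \<open>0 < e\<close> by (simp flip: ennreal_plus)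
      finally show ?thesis
        by (simp add: ennreal_less_iff dist_norm)
    qed
    then show "\<exists>N. \<forall>m\<ge>N. \<forall>n\<ge>N. dist (?I m) (?I n) < e" by blast
  qed
  then obtain J where J: "?I \<longlonglongrightarrow> J"
    using Cauchy_convergent convergent_def by blast
  then have "has_strong_integral M f J"
    using assms unfolding has_strong_integral_def by blast
  then show "strong_integrable M f" "?I \<longlonglongrightarrow> strong_integral M f"
    using J strong_integral_eq[of f J] by (auto simp: strong_integrable_def)
qed

section \<open>Approximation by simple functions\<close>

locale complete_prob_space = prob_space M + complete_measure M for M :: "'a measure"
begin

text \<open>The error is weighted by \<open>norm (f \<omega>)\<close> because this product controls
  the difference of the quadratic integrands of the covariances. The condition on \<open>s 0\<close>
  lets a telescoping series start from the zero operator.\<close>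

lemma L2_simple_approximation:
  fixes f :: "'a \<Rightarrow> 'b::real_normed_vector"
  assumes "f \<in> L2 M"
  shows "integrable M (\<lambda>\<omega>. (norm (f \<omega>))\<^sup>2)"
    and "\<exists>s. (\<forall>n. simple_function M (s n)) \<and> s 0 = (\<lambda>_. 0) \<and>
      (\<forall>n \<omega>. norm (s n \<omega>) \<le> 2 * norm (f \<omega>)) \<and>
      (\<forall>n. integrable M (\<lambda>\<omega>. norm (f \<omega>) * norm (f \<omega> - s n \<omega>))) \<and>
      summable (\<lambda>n. \<integral>\<omega>. norm (f \<omega>) * norm (f \<omega> - s n \<omega>) \<partial>M)"
proof -
  have f: "strongly_measurable M f" and fin: "(\<integral>\<^sup>+\<omega>. ennreal ((norm (f \<omega>))\<^sup>2) \<partial>M) < \<infinity>"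
    using assms by (auto simp: L2_def)
  have nf [measurable]: "(\<lambda>\<omega>. norm (f \<omega>)) \<in> borel_measurable M"
    by (rule borel_measurable_norm_strongly_measurable[OF f])
  show int: "integrable M (\<lambda>\<omega>. (norm (f \<omega>))\<^sup>2)"
    using fin by (intro integrableI_nonneg) auto
  obtain s where s: "\<And>n. simple_function M (s n)" "AE \<omega> in M. (\<lambda>n. s n \<omega>) \<longlonglongrightarrow> f \<omega>"
    using f by (auto simp: strongly_measurable_def)
  \<comment> \<open>Truncation gives domination by \<open>f\<close>. The factor 2 leaves room: where
    \<open>f \<omega>\<close> is nonzero, \<open>norm (s n \<omega>)\<close> is eventually below
    \<open>2 * norm (f \<omega>)\<close>, so the cut is eventually inactive; where
    \<open>f \<omega> = 0\<close> it forces the value 0.\<close>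
  define t where "t n \<omega> = (if norm (s n \<omega>) \<le> 2 * norm (f \<omega>) then s n \<omega> else 0)" for n \<omega>
  have [measurable]: "(\<lambda>\<omega>. norm (s n \<omega>)) \<in> borel_measurable M" for n
    by (rule borel_measurable_simple_function[OF simple_function_compose1[OF s(1)]])
  have t: "simple_function M (t n)" for n
    unfolding t_def by (intro simple_function_If s(1) simple_function_const) measurable
  have t_le: "norm (t n \<omega>) \<le> 2 * norm (f \<omega>)" for n \<omega>
    by (simp add: t_def)
  have t_lim: "AE \<omega> in M. (\<lambda>n. t n \<omega>) \<longlonglongrightarrow> f \<omega>"
    using s(2)
  proof eventually_elim
    case (elim \<omega>)
    show ?case
    proof (cases "f \<omega> = 0")
      case True
      then have "t n \<omega> = f \<omega>" for n
        by (simp add: t_def)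
      then show ?thesis by simp
    next
      case False
      have "\<forall>\<^sub>F n in sequentially. norm (s n \<omega>) < 2 * norm (f \<omega>)"
        by (rule order_tendstoD(2)[OF tendsto_norm[OF elim]]) (use False in simp)
      then have "\<forall>\<^sub>F n in sequentially. s n \<omega> = t n \<omega>"
        by eventually_elim (simp add: t_def)
      then show ?thesis
        using elim by (rule Lim_transform_eventually[rotated])
    qed
  qed
  define e where "e n \<omega> = norm (f \<omega>) * norm (f \<omega> - t n \<omega>)" for n \<omega>
  have [measurable]: "(\<lambda>\<omega>. norm (f \<omega> - t n \<omega>)) \<in> borel_measurable M" for n
    by (intro borel_measurable_norm_strongly_measurable strongly_measurable_diff f
        strongly_measurable_simple_function t)
  have [measurable]: "e n \<in> borel_measurable M" for n
    unfolding e_def by measurable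
  have e_nonneg: "0 \<le> e n \<omega>" for n \<omega>
    by (simp add: e_def)
  \<comment> \<open>The constant is 1 + 2, from \<open>norm (f \<omega>)\<close> and the truncation
    bound. The right side is the integrable majorant for dominated convergence.\<close>
  have e_le: "norm (e n \<omega>) \<le> 3 * (norm (f \<omega>))\<^sup>2" for n \<omega>
  proof -
    have "norm (f \<omega> - t n \<omega>) \<le> 3 * norm (f \<omega>)"
      using norm_triangle_ineq4[of "f \<omega>" "t n \<omega>"] t_le[of n \<omega>] by linarith
    then have "e n \<omega> \<le> norm (f \<omega>) * (3 * norm (f \<omega>))"
      unfolding e_def by (rule mult_left_mono) simp
    then show ?thesis
      using e_nonneg[of n \<omega>] by (simp add: power2_eq_square)
  qed
  have "(\<lambda>n. integral\<^sup>L M (e n)) \<longlonglongrightarrow> (\<integral>\<omega>. 0 \<partial>M)"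
  proof (rule integral_dominated_convergence[where w = "\<lambda>\<omega>. 3 * (norm (f \<omega>))\<^sup>2"])
    show "AE \<omega> in M. (\<lambda>n. e n \<omega>) \<longlonglongrightarrow> 0"
      using t_lim
    proof eventually_elim
      case (elim \<omega>)
      have "(\<lambda>n. e n \<omega>) \<longlonglongrightarrow> norm (f \<omega>) * norm (f \<omega> - f \<omega>)"
        unfolding e_def by (intro tendsto_intros elim)
      then show ?case by simp
    qed
  qed (use int e_le in auto)
  then have lim: "(\<lambda>n. integral\<^sup>L M (e n)) \<longlonglongrightarrow> 0" by simp
  \<comment> \<open>Selecting errors below a geometric sequence turns mere convergence to 0 into
    summability.\<close>
  have "\<exists>n. integral\<^sup>L M (e n) < (1 / 2) ^ k" for k
  proof -
    have "\<forall>\<^sub>F n in sequentially. integral\<^sup>L M (e n) < (1 / 2) ^ k"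
      by (rule order_tendstoD(2)[OF lim]) simp
    then show ?thesis
      by (rule eventually_happens'[OF sequentially_bot])
  qed
  then obtain r where r: "\<And>k. integral\<^sup>L M (e (r k)) < (1 / 2) ^ k"
    by metis
  \<comment> \<open>The zero function is put in front and the selected approximations shift by one
    index, which does not affect summability; the error at index 0 is
    \<open>(norm (f \<omega>))\<^sup>2\<close>.\<close>
  define u where "u n = (case n of 0 \<Rightarrow> (\<lambda>_. 0) | Suc k \<Rightarrow> t (r k))" for n
  have "integrable M (e n)" for n
    by (rule Bochner_Integration.integrable_bound[OF integrable_mult_right[OF int, of 3]])
      (use e_le in auto)
  then have u_int: "integrable M (\<lambda>\<omega>. norm (f \<omega>) * norm (f \<omega> - u n \<omega>))" for n
    using int by (auto simp: u_def e_def[abs_def] power2_eq_square split: nat.split)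
  have "summable (\<lambda>k. integral\<^sup>L M (e (r k)))"
    by (rule summable_comparison_test'[where N = 0, OF summable_geometric[of "1 / 2"]])
      (use r in \<open>auto simp: abs_of_nonneg e_nonneg less_imp_le\<close>)
  then have "summable (\<lambda>n. \<integral>\<omega>. norm (f \<omega>) * norm (f \<omega> - u n \<omega>) \<partial>M)"
    by (subst summable_Suc_iff[symmetric]) (simp add: u_def e_def[abs_def])
  moreover have "simple_function M (u n)" "norm (u n \<omega>) \<le> 2 * norm (f \<omega>)" for n \<omega>
    using t t_le by (auto simp: u_def split: nat.split)
  moreover have "u 0 = (\<lambda>_. 0)"
    by (simp add: u_def)
  ultimately show "\<exists>s. (\<forall>n. simple_function M (s n)) \<and> s 0 = (\<lambda>_. 0) \<and>
      (\<forall>n \<omega>. norm (s n \<omega>) \<le> 2 * norm (f \<omega>)) \<and>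
      (\<forall>n. integrable M (\<lambda>\<omega>. norm (f \<omega>) * norm (f \<omega> - s n \<omega>))) \<and>
      summable (\<lambda>n. \<integral>\<omega>. norm (f \<omega>) * norm (f \<omega> - s n \<omega>) \<partial>M)"
    using u_int by (intro exI[of _ u]) blast
qed

end

section \<open>The auto-covariance operator\<close>

text \<open>One approximating sequence is fixed, so that all properties of the operator come from
  the same finite-rank covariances.\<close>

locale approximated_random_function = complete_prob_space M for M :: "'a measure" +
  fixes f :: "'a \<Rightarrow> 'h::chilbert_space" and s :: "nat \<Rightarrow> 'a \<Rightarrow> 'h"
  assumes f: "strongly_measurable M f"
    and square_integrable: "integrable M (\<lambda>\<omega>. (norm (f \<omega>))\<^sup>2)"
    and simple: "\<And>n. simple_function M (s n)"
    and s_0: "s 0 = (\<lambda>_. 0)"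
    and norm_s_le: "\<And>n \<omega>. norm (s n \<omega>) \<le> 2 * norm (f \<omega>)"
    and error_integrable: "\<And>n. integrable M (\<lambda>\<omega>. norm (f \<omega>) * norm (f \<omega> - s n \<omega>))"
    and error_summable: "summable (\<lambda>n. \<integral>\<omega>. norm (f \<omega>) * norm (f \<omega> - s n \<omega>) \<partial>M)"
begin

section \<open>Finite-rank covariances of the approximations and their pointwise limit\<close>

definition err :: "nat \<Rightarrow> real" where
  "err n = (\<integral>\<omega>. norm (f \<omega>) * norm (f \<omega> - s n \<omega>) \<partial>M)"

text \<open>The auto-covariance of the simple function \<open>s n\<close>, written as a finite
  combination of the rank-one maps sending \<open>x\<close> to
  \<open>cinner x v *\<^sub>C v\<close>.\<close>

definition cov :: "nat \<Rightarrow> 'h \<Rightarrow> 'h" where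
  "cov n x = (\<Sum>v\<in>s n ` space M. prob {\<omega>\<in>space M. s n \<omega> = v} *\<^sub>R cinner x v *\<^sub>C v)"

lemma cov_eq: "cov n x = simple_bochner_integral M (\<lambda>\<omega>. cinner x (s n \<omega>) *\<^sub>C s n \<omega>)"
  unfolding cov_def by (rule simple_bochner_integral_compose[OF simple, symmetric])

lemma strongly_measurable_integrand: "strongly_measurable M (\<lambda>\<omega>. cinner x (f \<omega>) *\<^sub>C f \<omega>)"
  by (rule strongly_measurable_compose2[OF f f, where h = "\<lambda>a b. cinner x a *\<^sub>C b"])
    (intro tendsto_scaleC tendsto_cinner tendsto_const)

text \<open>With \<open>d = f \<omega> - s n \<omega>\<close>, the difference splits into
  \<open>cinner x d *\<^sub>C f \<omega>\<close> and
  \<open>cinner x (s n \<omega>) *\<^sub>C d\<close>. Cauchy-Schwarz and \<open>norm_s_le\<close>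
  bound these with constants 1 and 2.\<close>

lemma integrand_diff_le:
  "norm (cinner x (f \<omega>) *\<^sub>C f \<omega> - cinner x (s n \<omega>) *\<^sub>C s n \<omega>) \<le>
    3 * norm x * (norm (f \<omega>) * norm (f \<omega> - s n \<omega>))"
proof -
  let ?d = "f \<omega> - s n \<omega>"
  have "cinner x (f \<omega>) *\<^sub>C f \<omega> - cinner x (s n \<omega>) *\<^sub>C s n \<omega> =
      cinner x ?d *\<^sub>C f \<omega> + cinner x (s n \<omega>) *\<^sub>C ?d"
    by (simp add: cinner_diff_right scaleC_diff_left scaleC_diff_right)
  also have "norm \<dots> \<le> cmod (cinner x ?d) * norm (f \<omega>) + cmod (cinner x (s n \<omega>)) * norm ?d"
    by (metis norm_scaleC norm_triangle_ineq)
  also have "\<dots> \<le> (norm x * norm ?d) * norm (f \<omega>) + (norm x * (2 * norm (f \<omega>))) * norm ?d"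
    by (intro add_mono mult_right_mono cinner_cauchy_schwarz norm_ge_zero
        order_trans[OF cinner_cauchy_schwarz mult_left_mono[OF norm_s_le]])
  also have "\<dots> = 3 * norm x * (norm (f \<omega>) * norm ?d)"
    by (simp add: algebra_simps)
  finally show ?thesis .
qed

text \<open>The L1 distance between the integrands is at most \<open>3 * norm x * err n\<close>, and
  \<open>err n\<close> tends to 0 as the general term of a convergent series.\<close>

lemma strong_integrable_integrand: "strong_integrable M (\<lambda>\<omega>. cinner x (f \<omega>) *\<^sub>C f \<omega>)"
  and cov_tendsto: "(\<lambda>n. cov n x) \<longlonglongrightarrow> auto_covariance M f x"
proof -
  have le: "(\<integral>\<^sup>+\<omega>. ennreal (norm (cinner x (f \<omega>) *\<^sub>C f \<omega> - cinner x (s n \<omega>) *\<^sub>C s n \<omega>)) \<partial>M) \<le>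
      ennreal (3 * norm x * err n)" for n
  proof -
    have "(\<integral>\<^sup>+\<omega>. ennreal (norm (cinner x (f \<omega>) *\<^sub>C f \<omega> - cinner x (s n \<omega>) *\<^sub>C s n \<omega>)) \<partial>M) \<le>
        (\<integral>\<^sup>+\<omega>. ennreal (3 * norm x * (norm (f \<omega>) * norm (f \<omega> - s n \<omega>))) \<partial>M)"
      by (intro nn_integral_mono ennreal_leI integrand_diff_le)
    also have "\<dots> = ennreal (3 * norm x * err n)"
      unfolding err_def using error_integrable[of n]
      by (subst nn_integral_eq_integral) auto
    finally show ?thesis .
  qed
  have err: "(\<lambda>n. ennreal (3 * norm x * err n)) \<longlonglongrightarrow> ennreal (3 * norm x * 0)"
    using summable_LIMSEQ_zero[OF error_summable, folded err_def]
    by (intro tendsto_ennrealI tendsto_mult tendsto_const)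
  have lim: "(\<lambda>n. \<integral>\<^sup>+\<omega>. ennreal (norm (cinner x (f \<omega>) *\<^sub>C f \<omega> - cinner x (s n \<omega>) *\<^sub>C s n \<omega>)) \<partial>M)
      \<longlonglongrightarrow> 0"
    by (rule tendsto_sandwich[OF always_eventually always_eventually tendsto_const err[simplified]])
      (simp_all add: le)
  have "simple_bochner_integrable M (\<lambda>\<omega>. cinner x (s n \<omega>) *\<^sub>C s n \<omega>)" for n
    by (rule simple_bochner_integrable_simple_function[OF simple_function_compose1[OF simple]])
  from has_strong_integralI[OF strongly_measurable_integrand this lim]
  show "strong_integrable M (\<lambda>\<omega>. cinner x (f \<omega>) *\<^sub>C f \<omega>)"
    "(\<lambda>n. cov n x) \<longlonglongrightarrow> auto_covariance M f x"
    by (simp_all add: cov_eq auto_covariance_def)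
qed

section \<open>Uniform second-moment bound and the properties inherited by the limit
  operator\<close>

definition energy :: real where "energy = 4 * (\<integral>\<omega>. (norm (f \<omega>))\<^sup>2 \<partial>M)"

text \<open>The left side is the second moment of \<open>s n\<close>, which is also the trace of
  \<open>cov n\<close>. The factor 4 in \<open>energy\<close> is the square of the 2 in
  \<open>norm_s_le\<close>.\<close>

lemma energy_bound: "(\<Sum>v\<in>s n ` space M. prob {\<omega>\<in>space M. s n \<omega> = v} * (norm v)\<^sup>2) \<le> energy"
proof -
  have "(\<Sum>v\<in>s n ` space M. prob {\<omega>\<in>space M. s n \<omega> = v} * (norm v)\<^sup>2) =
      (\<integral>\<omega>. (norm (s n \<omega>))\<^sup>2 \<partial>M)"
    by (rule lebesgue_integral_compose_simple_function[OF simple, symmetric])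
  also have "\<dots> \<le> (\<integral>\<omega>. 4 * (norm (f \<omega>))\<^sup>2 \<partial>M)"
  proof (rule integral_mono)
    show "(norm (s n \<omega>))\<^sup>2 \<le> 4 * (norm (f \<omega>))\<^sup>2" for \<omega>
      using power_mono[OF norm_s_le[of n \<omega>], of 2] by (simp add: power_mult_distrib)
  qed (use square_integrable in
      \<open>auto intro: integrable_simple_function_real[OF simple_function_compose1[OF simple]]\<close>)
  finally show ?thesis by (simp add: energy_def)
qed

lemma cov_add: "cov n (x + y) = cov n x + cov n y"
  by (simp add: cov_def cinner_add_left scaleC_add_left scaleR_add_right sum.distrib)

lemma cov_scaleC: "cov n (a *\<^sub>C x) = a *\<^sub>C cov n x"
  by (simp add: cov_def cinner_scaleC_left scaleC_sum_right scaleR_scaleC scaleC_scaleC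
      mult.left_commute)

lemma norm_cov_le: "norm (cov n x) \<le> norm x * energy"
proof -
  have "norm (cov n x) \<le> (\<Sum>v\<in>s n ` space M. norm x * (prob {\<omega>\<in>space M. s n \<omega> = v} * (norm v)\<^sup>2))"
    unfolding cov_def
  proof (rule sum_norm_le)
    fix v
    have "cmod (cinner x v) * norm v \<le> (norm x * norm v) * norm v"
      by (intro mult_right_mono cinner_cauchy_schwarz) simp
    then show "norm (prob {\<omega>\<in>space M. s n \<omega> = v} *\<^sub>R cinner x v *\<^sub>C v) \<le>
        norm x * (prob {\<omega>\<in>space M. s n \<omega> = v} * (norm v)\<^sup>2)"
      using mult_left_mono[of _ _ "prob {\<omega>\<in>space M. s n \<omega> = v}"]
      by (fastforce simp: norm_scaleC power2_eq_square ac_simps)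
  qed
  also have "\<dots> \<le> norm x * energy"
    unfolding sum_distrib_left[symmetric] by (intro mult_left_mono energy_bound) simp
  finally show ?thesis .
qed

text \<open>Linearity passes to pointwise limits; boundedness does too because the bound in
  \<open>norm_cov_le\<close> is the same for all \<open>n\<close>.\<close>

lemma bounded_clinear_auto_covariance: "bounded_clinear (auto_covariance M f)"
proof -
  let ?T = "auto_covariance M f"
  have scaleC: "?T (a *\<^sub>C x) = a *\<^sub>C ?T x" for a x
    using cov_tendsto[of "a *\<^sub>C x"] unfolding cov_scaleC
    by (rule LIMSEQ_unique) (intro tendsto_scaleC tendsto_const cov_tendsto)
  have "bounded_linear ?T"
  proof (rule bounded_linear_intro)
    show "?T (x + y) = ?T x + ?T y" for x y
      using cov_tendsto[of "x + y"] unfolding cov_add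
      by (rule LIMSEQ_unique) (intro tendsto_add cov_tendsto)
    show "?T (r *\<^sub>R x) = r *\<^sub>R ?T x" for r x
      by (simp add: scaleR_scaleC scaleC)
    show "norm (?T x) \<le> norm x * energy" for x
      by (rule Lim_bounded[OF tendsto_norm[OF cov_tendsto]]) (simp add: norm_cov_le)
  qed
  then show ?thesis
    by (simp add: bounded_clinear_def scaleC)
qed

lemma cinner_cov: "cinner (cov n x) y =
    (\<Sum>v\<in>s n ` space M. of_real (prob {\<omega>\<in>space M. s n \<omega> = v}) * (cinner x v * cinner v y))"
  by (simp add: cov_def cinner_sum_left cinner_scaleR_left cinner_scaleC_left)

lemma cinner_cov_self: "cinner (cov n x) x =
    of_real (\<Sum>v\<in>s n ` space M. prob {\<omega>\<in>space M. s n \<omega> = v} * (cmod (cinner x v))\<^sup>2)"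
proof -
  have "cinner x v * cinner v x = of_real ((cmod (cinner x v))\<^sup>2)" for v
    by (metis cinner_commute complex_norm_square)
  then show ?thesis
    by (simp add: cinner_cov)
qed

lemma is_cadjoint_auto_covariance: "is_cadjoint (auto_covariance M f) (auto_covariance M f)"
  unfolding is_cadjoint_def
proof (intro allI)
  fix x y
  \<comment> \<open>Both sides are the weighted sum of the products
    \<open>cinner x v * cinner v y\<close>, with real weights.\<close>
  have cov: "cinner (cov n x) y = cinner x (cov n y)" for n
    by (simp add: cov_def cinner_sum_left cinner_sum_right cinner_scaleR_left cinner_scaleR_right
        cinner_scaleC_left cinner_scaleC_right cinner_commute[of _ y] mult.commute)
  have "(\<lambda>n. cinner (cov n x) y) \<longlonglongrightarrow> cinner (auto_covariance M f x) y"
    by (intro tendsto_cinner cov_tendsto tendsto_const)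
  moreover have "(\<lambda>n. cinner x (cov n y)) \<longlonglongrightarrow> cinner x (auto_covariance M f y)"
    by (intro tendsto_cinner cov_tendsto tendsto_const)
  ultimately show "cinner (auto_covariance M f x) y = cinner x (auto_covariance M f y)"
    unfolding cov by (rule LIMSEQ_unique)
qed

text \<open>The quadratic form of \<open>cov n\<close> is a sum of nonnegative reals, and vanishing
  imaginary part and nonnegative real part both survive the limit.\<close>

lemma positive_auto_covariance: "positive_operator (auto_covariance M f)"
  unfolding positive_operator_def
proof (intro conjI allI bounded_clinear_auto_covariance)
  fix x
  have lim: "(\<lambda>n. cinner (cov n x) x) \<longlonglongrightarrow> cinner (auto_covariance M f x) x"
    by (intro tendsto_cinner cov_tendsto tendsto_const)
  have "0 \<le> Re (cinner (auto_covariance M f x) x)"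
    by (rule LIMSEQ_le_const[OF tendsto_Re[OF lim]])
      (auto simp: cinner_cov_self intro!: sum_nonneg simp del: of_real_sum)
  moreover have "Im (cinner (auto_covariance M f x) x) = 0"
    using tendsto_Im[OF lim] unfolding cinner_cov_self by (simp add: LIMSEQ_const_iff del: of_real_sum)
  ultimately show "cinner (auto_covariance M f x) x \<in> \<real>\<^sub>\<ge>\<^sub>0"
    by (simp add: complex_nonneg_Reals_iff)
qed

lemma trace_class_auto_covariance: "trace_class (auto_covariance M f)"
proof -
  let ?T = "auto_covariance M f"
  obtain B :: "'h set" where B: "orthonormal_basis B"
    using ex_orthonormal_basis by blast
  \<comment> \<open>A positive self-adjoint operator is its own modulus: the adjoint is
    \<open>?T\<close>, so both compositions are \<open>?T \<circ> ?T\<close>.\<close>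
  have "is_modulus ?T ?T"
    unfolding is_modulus_def using positive_auto_covariance is_cadjoint_auto_covariance by blast
  moreover have "(\<lambda>e. Re (cinner (?T e) e)) summable_on B"
  proof (rule nonneg_bdd_above_summable_on)
    show "0 \<le> Re (cinner (?T e) e)" for e
      using positive_auto_covariance by (simp add: positive_operator_def complex_nonneg_Reals_iff)
    \<comment> \<open>Finite partial sums are bounded for each \<open>cov n\<close> and then in the
      limit. Exchanging the two finite sums allows Bessel's inequality at each value
      \<open>v\<close>.\<close>
    have "(\<Sum>e\<in>F. Re (cinner (?T e) e)) \<le> energy" if F: "F \<subseteq> B" "finite F" for F
    proof (rule Lim_bounded)
      show "(\<lambda>n. \<Sum>e\<in>F. Re (cinner (cov n e) e)) \<longlonglongrightarrow> (\<Sum>e\<in>F. Re (cinner (?T e) e))"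
        by (intro tendsto_sum tendsto_Re tendsto_cinner cov_tendsto tendsto_const)
      have "(\<Sum>e\<in>F. Re (cinner (cov n e) e)) \<le> energy" for n
      proof -
        have "(\<Sum>e\<in>F. Re (cinner (cov n e) e)) =
            (\<Sum>v\<in>s n ` space M. prob {\<omega>\<in>space M. s n \<omega> = v} * (\<Sum>e\<in>F. (cmod (cinner v e))\<^sup>2))"
        proof -
          have "cmod (cinner e v) = cmod (cinner v e)" for e v :: 'h
            by (metis cinner_commute complex_mod_cnj)
          then show ?thesis
            unfolding cinner_cov_self Re_complex_of_real sum_distrib_left by (subst sum.swap) simp
        qed
        also have "\<dots> \<le> (\<Sum>v\<in>s n ` space M. prob {\<omega>\<in>space M. s n \<omega> = v} * (norm v)\<^sup>2)"
          using F B by (intro sum_mono mult_left_mono bessel_inequality)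
            (auto simp: orthonormal_basis_def subset_iff)
        also have "\<dots> \<le> energy"
          by (rule energy_bound)
        finally show ?thesis .
      qed
      then show "\<forall>n\<ge>0. (\<Sum>e\<in>F. Re (cinner (cov n e) e)) \<le> energy" by blast
    qed
    then show "bdd_above (sum (\<lambda>e. Re (cinner (?T e) e)) ` {F. F \<subseteq> B \<and> finite F})"
      by (intro bdd_aboveI2[where M = energy]) auto
  qed
  ultimately show ?thesis
    using bounded_clinear_auto_covariance B unfolding trace_class_def by blast
qed

text \<open>
  The telescoping series of the covariances of the approximations, with each difference
  \<open>\<langle>x,b\<rangle>b - \<langle>x,a\<rangle>a = \<langle>x,b-a\<rangle>b + \<langle>x,a\<rangle>(b-a)\<close> split into two rank-one terms, represents the operator.
\<close>

lemma nuclear_auto_covariance: "nuclear (auto_covariance M f)"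
proof -
  \<comment> \<open>The joint simple function puts two consecutive covariances over one common
    finite set of value pairs.\<close>
  define p where "p n \<omega> = (s n \<omega>, s (Suc n) \<omega>)" for n \<omega>
  define m where "m n v = prob {\<omega>\<in>space M. p n \<omega> = v}" for n v
  \<comment> \<open>An index holds the telescoping step, a value pair \<open>(a, b)\<close> and a
    Boolean choosing a rank-one term: True for \<open>cinner x (b - a) *\<^sub>C b\<close>, False
    for \<open>cinner x a *\<^sub>C (b - a)\<close>. Here \<open>\<alpha>\<close> is the vector
    inside the functional and \<open>\<beta>\<close> the one outside.\<close>
  define I where "I = Sigma (UNIV :: nat set) (\<lambda>n. p n ` space M \<times> (UNIV :: bool set))"
  define \<alpha> where "\<alpha> = (\<lambda>(v :: 'h \<times> 'h, c). if c then snd v - fst v else fst v)"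
  define \<beta> where "\<beta> = (\<lambda>(v :: 'h \<times> 'h, c). if c then snd v else snd v - fst v)"
  define \<phi> where "\<phi> = (\<lambda>(n, v, c) x. of_real (m n v) * cinner x (\<alpha> (v, c)))"
  define y where "y = (\<lambda>(n :: nat, j). \<beta> j)"
  \<comment> \<open>\<open>B\<close> majorises the nuclear norm of each rank-one term, and
    \<open>b n\<close> is its total over step \<open>n\<close>.\<close>
  define B where "B = (\<lambda>(n, v, c). m n v * norm (\<alpha> (v, c)) * norm (\<beta> (v, c)))"
  define b where "b n = (\<Sum>v\<in>p n ` space M. m n v *
    (norm (snd v - fst v) * norm (snd v) + norm (fst v) * norm (snd v - fst v)))" for n
  have p: "simple_function M (p n)" for n
    unfolding p_def by (intro simple_function_Pair simple)
  then have fin: "finite (p n ` space M)" for n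
    by (simp add: simple_function_def)
  have m: "0 \<le> m n v" for n v
    by (simp add: m_def)
  have sum_J: "sum h (p n ` space M \<times> (UNIV :: bool set)) =
      (\<Sum>v\<in>p n ` space M. h (v, True) + h (v, False))" for n and h :: "_ \<Rightarrow> 'c::comm_monoid_add"
    by (simp add: sum.cartesian_product' UNIV_bool add.commute)
  have has_sum_J: "(h has_sum (\<Sum>v\<in>p n ` space M. h (v, True) + h (v, False)))
      (p n ` space M \<times> UNIV)" for n and h :: "_ \<Rightarrow> 'c::{comm_monoid_add,topological_space}"
    unfolding sum_J[symmetric] by (rule has_sum_finite) (simp add: fin)

  \<comment> \<open>As an expectation, \<open>b n\<close> has integrand
    \<open>norm (b - a) * (norm b + norm a)\<close>. The first factor is at most the sum of the two
    approximation errors, the second at most \<open>4 * norm (f \<omega>)\<close>.\<close>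
  have b_le: "b n \<le> 4 * (err n + err (Suc n))" for n
  proof -
    let ?g = "\<lambda>v. norm (snd v - fst v) * norm (snd v) + norm (fst v) * norm (snd v - fst v :: 'h)"
    have "b n = (\<integral>\<omega>. ?g (p n \<omega>) \<partial>M)"
      unfolding b_def m_def by (rule lebesgue_integral_compose_simple_function[OF p, symmetric])
    also have "\<dots> \<le> (\<integral>\<omega>. 4 * (norm (f \<omega>) * norm (f \<omega> - s n \<omega>) +
        norm (f \<omega>) * norm (f \<omega> - s (Suc n) \<omega>)) \<partial>M)"
    proof (rule integral_mono)
      show "integrable M (\<lambda>\<omega>. ?g (p n \<omega>))"
        by (rule integrable_simple_function_real[OF simple_function_compose1[OF p]])
      show "integrable M (\<lambda>\<omega>. 4 * (norm (f \<omega>) * norm (f \<omega> - s n \<omega>) +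
          norm (f \<omega>) * norm (f \<omega> - s (Suc n) \<omega>)))"
        by (intro integrable_mult_right Bochner_Integration.integrable_add error_integrable)
    next
      fix \<omega>
      let ?a = "s n \<omega>" and ?b = "s (Suc n) \<omega>"
      have d: "norm (?b - ?a) \<le> norm (f \<omega> - ?a) + norm (f \<omega> - ?b)"
        by (metis dual_order.refl norm_diff_triangle_le norm_minus_commute add.commute)
      have "?g (p n \<omega>) = norm (?b - ?a) * (norm ?b + norm ?a)"
        by (simp add: p_def algebra_simps)
      also have "\<dots> \<le> (norm (f \<omega> - ?a) + norm (f \<omega> - ?b)) * (4 * norm (f \<omega>))"
        using norm_s_le[of n \<omega>] norm_s_le[of "Suc n" \<omega>] by (intro mult_mono d) auto
      finally show "?g (p n \<omega>) \<le> 4 * (norm (f \<omega>) * norm (f \<omega> - ?a) + norm (f \<omega>) * norm (f \<omega> - ?b))"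
        by (simp add: algebra_simps)
    qed
    also have "\<dots> = 4 * (err n + err (Suc n))"
      by (simp add: err_def error_integrable)
    finally show ?thesis .
  qed
  have b_nonneg: "0 \<le> b n" for n
    unfolding b_def by (intro sum_nonneg mult_nonneg_nonneg add_nonneg_nonneg m) auto
  have err_summable: "summable err"
    using error_summable by (simp add: err_def[abs_def])
  then have "summable (\<lambda>n. 4 * (err n + err (Suc n)))"
    by (intro summable_mult summable_add) (simp_all add: summable_Suc_iff)
  then have "summable b"
    by (rule summable_comparison_test'[where N = 0]) (use b_le b_nonneg in auto)
  then have b_summable: "b summable_on UNIV"
    by (simp add: summable_on_UNIV_nonneg_real_iff b_nonneg)
  \<comment> \<open>For nonnegative terms, summing each finite fibre to \<open>b n\<close> and then
    summing over \<open>n\<close> gives summability over all indices.\<close>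
  have B_summable: "B summable_on I"
    unfolding I_def
  proof (rule summable_on_SigmaI[OF _ b_summable])
    show "((\<lambda>j. B (n, j)) has_sum b n) (p n ` space M \<times> UNIV)" for n
      using has_sum_J[of "\<lambda>j. B (n, j)" n]
      by (simp add: B_def b_def \<alpha>_def \<beta>_def algebra_simps)
  qed (auto simp: B_def m)

  have \<phi>_le: "norm (\<phi> i x) \<le> norm x * (case i of (n, v, c) \<Rightarrow> m n v * norm (\<alpha> (v, c)))" for i x
  proof (cases i)
    case (fields n v c)
    have "m n v * cmod (cinner x (\<alpha> (v, c))) \<le> m n v * (norm x * norm (\<alpha> (v, c)))"
      by (intro mult_left_mono cinner_cauchy_schwarz m)
    then show ?thesis
      by (simp add: fields \<phi>_def norm_mult m ac_simps)
  qed
  have \<phi>: "bounded_clinear (\<phi> i)" for i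
    unfolding bounded_clinear_def
  proof
    show "bounded_linear (\<phi> i)"
      by (rule bounded_linear_intro[OF _ _ \<phi>_le])
        (auto simp: \<phi>_def cinner_add_left cinner_scaleR_left scaleR_conv_of_real algebra_simps
          split: prod.split)
    show "\<forall>a x. \<phi> i (a *\<^sub>C x) = a *\<^sub>C \<phi> i x"
      by (auto simp: \<phi>_def cinner_scaleC_left scaleC_complex_def split: prod.split)
  qed
  have bound: "onorm (\<phi> i) * norm (y i) \<le> B i" for i
  proof -
    have "onorm (\<phi> i) \<le> (case i of (n, v, c) \<Rightarrow> m n v * norm (\<alpha> (v, c)))"
      by (rule onorm_bound) (use \<phi>_le in \<open>auto simp: m mult.commute split: prod.split\<close>)
    then have "onorm (\<phi> i) * norm (y i) \<le> (case i of (n, v, c) \<Rightarrow> m n v * norm (\<alpha> (v, c))) * norm (y i)"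
      by (rule mult_right_mono) simp
    then show ?thesis
      by (cases i) (simp add: B_def y_def)
  qed
  have onorm_nonneg: "0 \<le> onorm (\<phi> i)" for i
    using \<phi>[of i] by (intro onorm_pos_le) (simp add: bounded_clinear_def)

  show ?thesis
  proof (rule nuclear_countableI[OF bounded_clinear_auto_covariance])
    show "countable I"
      unfolding I_def by (rule countable_SIGMA) (simp_all add: fin countable_finite)
    have "(\<lambda>i. norm (onorm (\<phi> i) * norm (y i))) summable_on I"
      by (rule Infinite_Sum.abs_summable_on_comparison_test'[OF B_summable])
        (use bound onorm_nonneg in simp)
    then show "(\<lambda>i. onorm (\<phi> i) * norm (y i)) summable_on I"
      using onorm_nonneg by simp
  next
    fix x
    let ?t = "\<lambda>i. \<phi> i x *\<^sub>C y i"
    \<comment> \<open>Absolute summability, dominated by \<open>norm x * B i\<close>, provides some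
      sum \<open>S\<close> in the complete space; it is identified afterwards by summing fibre by
      fibre.\<close>
    have "(\<lambda>i. norm (?t i)) summable_on I"
    proof (rule Infinite_Sum.abs_summable_on_comparison_test'[OF summable_on_cmult_right[OF B_summable]])
      show "norm (?t i) \<le> norm x * B i" for i
        using mult_right_mono[OF \<phi>_le[of i x] norm_ge_zero[of "y i"]]
        by (cases i) (simp add: norm_scaleC B_def y_def mult.assoc)
    qed
    then have "?t summable_on I"
      by (rule Infinite_Sum.abs_summable_summable)
    then obtain S where S: "(?t has_sum S) I"
      by (auto simp: summable_on_def)
    have "((\<lambda>n. cov (Suc n) x - cov n x) has_sum S) UNIV"
    proof (rule has_sum_SigmaD[OF S[unfolded I_def]])
      fix n
      have "(\<Sum>v\<in>p n ` space M. ?t (n, v, True) + ?t (n, v, False)) = (\<Sum>v\<in>p n ` space M.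
          m n v *\<^sub>R (cinner x (snd v) *\<^sub>C snd v) - m n v *\<^sub>R (cinner x (fst v) *\<^sub>C fst v))"
      proof (rule sum.cong[OF refl])
        fix v
        have "?t (n, v, True) + ?t (n, v, False) =
            m n v *\<^sub>R (cinner x (snd v - fst v) *\<^sub>C snd v + cinner x (fst v) *\<^sub>C (snd v - fst v))"
          by (simp add: \<phi>_def y_def \<alpha>_def \<beta>_def scaleC_add_right scaleR_scaleC scaleC_scaleC)
        also have "cinner x (snd v - fst v) *\<^sub>C snd v + cinner x (fst v) *\<^sub>C (snd v - fst v) =
            cinner x (snd v) *\<^sub>C snd v - cinner x (fst v) *\<^sub>C fst v"
          by (simp add: cinner_diff_right scaleC_diff_left scaleC_diff_right)
        finally show "?t (n, v, True) + ?t (n, v, False) =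
            m n v *\<^sub>R (cinner x (snd v) *\<^sub>C snd v) - m n v *\<^sub>R (cinner x (fst v) *\<^sub>C fst v)"
          by (simp add: scaleR_diff_right)
      qed
      \<comment> \<open>Grouping by the pair \<open>p n\<close> and applying a function of one
        component recovers the covariance of that component.\<close>
      also have "\<dots> = cov (Suc n) x - cov n x"
        using simple_bochner_integral_compose[OF p[of n], of "\<lambda>v. cinner x (snd v) *\<^sub>C snd v"]
          simple_bochner_integral_compose[OF p[of n], of "\<lambda>v. cinner x (fst v) *\<^sub>C fst v"]
        by (simp add: cov_eq m_def sum_subtractf) (simp add: p_def)
      finally show "((\<lambda>j. ?t (n, j)) has_sum cov (Suc n) x - cov n x) (p n ` space M \<times> UNIV)"
        using has_sum_J[of "\<lambda>j. ?t (n, j)" n] by simp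
    qed
    then have "(\<lambda>n. cov (Suc n) x - cov n x) sums S"
      by (rule has_sum_imp_sums)
    \<comment> \<open>The series telescopes to the limit minus \<open>cov 0 x\<close>, which
      vanishes as \<open>s 0\<close> is zero; uniqueness of sums then determines
      \<open>S\<close>.\<close>
    moreover have "(\<lambda>n. cov (Suc n) x - cov n x) sums (auto_covariance M f x - cov 0 x)"
      by (rule telescope_sums[OF cov_tendsto])
    moreover have "cov 0 x = 0"
      unfolding cov_def by (rule sum.neutral) (auto simp: s_0)
    ultimately show "(?t has_sum auto_covariance M f x) I"
      using S sums_unique2 by fastforce
  qed (rule \<phi>)
qed

end

theorem mainTheorem3:
  fixes M :: "'a measure" and f :: "'a \<Rightarrow> 'h::chilbert_space"
  assumes prob: "prob_space M"
    and complete: "complete_measure M"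
    and f_L2: "f \<in> L2 M"
    and zero_mean: "strong_integral M f = 0"
  shows "(\<forall>x. strong_integrable M (\<lambda>\<omega>. cinner x (f \<omega>) *\<^sub>C f \<omega>)) \<and>
    bounded_clinear (auto_covariance M f) \<and>
    nuclear (auto_covariance M f) \<and>
    trace_class (auto_covariance M f)"
proof -
  interpret complete_prob_space M
    using prob complete by (simp add: complete_prob_space_def)
  have f: "strongly_measurable M f"
    using f_L2 by (simp add: L2_def)
  from L2_simple_approximation(2)[OF f_L2] obtain s where
    s: "\<forall>n. simple_function M (s n)" "s 0 = (\<lambda>_. 0)" "\<forall>n \<omega>. norm (s n \<omega>) \<le> 2 * norm (f \<omega>)"
      "\<forall>n. integrable M (\<lambda>\<omega>. norm (f \<omega>) * norm (f \<omega> - s n \<omega>))"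
      "summable (\<lambda>n. \<integral>\<omega>. norm (f \<omega>) * norm (f \<omega> - s n \<omega>) \<partial>M)"
    by (elim exE conjE)
  \<comment> \<open>The operator \<open>auto_covariance M f\<close> does not depend on the chosen
    \<open>s\<close>, so the conclusions of this context transfer directly.\<close>
  interpret approximated_random_function M f s
    by unfold_locales (use s f L2_simple_approximation(1)[OF f_L2] in simp_all)
  show ?thesis
    using strong_integrable_integrand bounded_clinear_auto_covariance nuclear_auto_covariance
      trace_class_auto_covariance by blast
qed

end
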